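(* Let $\partial D_m$ be an ellipse parameterized by $w_m=(a_m,b_m,\theta_m,x_{1,m},x_{2,m})$ with $a_m>b_m>0$, and let $\mathcal K_{w_m}$ and $\mathcal S^*_{w_m}$ be the adjoint parameterized Laplace boundary operators defined in the context. Put $\alpha_{m,i}=\frac12e^{-2i\rho_m}$ and $$q^s_{m,i}(t)=\sin(it)\,\Xi(\rho_m,t)\quad(i\ge1),\qquad q^c_{m,i}(t)=\cos(it)\,\Xi(\rho_m,t)\quad(i\ge0),$$ where $i$ denotes an integer index. Then the $i$-th order eigenvalues and corresponding eigenfunctions of $\mathcal K_{w_m}$ are given by $$\mathcal K_{w_m}[q^s_{m,i}]=-\alpha_{m,i}\,q^s_{m,i},\qquad \mathcal K_{w_m}[q^c_{m,i}]=\alpha_{m,i}\,q^c_{m,i}.$$ Furthermore, for $i\ge1$, $$\mathcal S^*_{w_m}[\sin(is)]=-\frac1i\left(\frac12-\alpha_{m,i}\right)q^s_{m,i},\qquad \mathcal S^*_{w_m}[\cos(is)]=-\frac1i\left(\frac12+\alpha_{m,i}\right)q^c_{m,i},$$ and in the special case $i=0$, $\mathcal S^*_{w_m}[\cos(is)](t)=\left(\rho_m+\ln(c_m/2)\right)\Xi(\rho_m,t)$.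
   Context: Ellipse: for $t\in[0,2\pi)$, $$x(t;w_m)=\begin{bmatrix}\cos\theta_m&-\sin\theta_m\\ \sin\theta_m&\cos\theta_m\end{bmatrix}\begin{bmatrix}a_m\cos t\\ b_m\sin t\end{bmatrix}+\begin{bmatrix}x_{1,m}\\ x_{2,m}\end{bmatrix},$$ where $a_m,b_m$ are the semi-major and semi-minor axes, $\theta_m$ the rotation angle and $(x_{1,m},x_{2,m})$ the centre. Set $c_m=\sqrt{a_m^2-b_m^2}$, $\rho_m=\ln\big((a_m+b_m)/c_m\big)$ (so $a_m=c_m\cosh\rho_m$, $b_m=c_m\sinh\rho_m$), and $\Xi(\rho_m,t)=c_m\sqrt{\sinh^2\rho_m+\sin^2t}$, which equals $|x'(t;w_m)|$. Operators: $G(z)=\frac1{2\pi}\ln|z|$, and $y(s;w_m)$ denotes the same curve as $x$ with parameter $s$. The parameterized single layer and Neumann–Poincaré operators on $L^2([0,2\pi),\mathbb C)$ are $$\mathcal S_{w_m}[\psi](t)=\int_0^{2\pi}G(x(t;w_m)-y(s;w_m))|y'(s;w_m)|\psi(s)\,\mathrm ds,\quad \mathcal K^*_{w_m}[\psi](t)=\int_0^{2\pi}\frac{\partial G(x(t;w_m)-y(s;w_m))}{\partial\nu_x(t;w_m)}|y'(s;w_m)|\psi(s)\,\mathrm ds,$$ with $\nu$ the outward unit normal. Their adjoints with respect to the standard inner product of $L^2([0,2\pi),\mathbb C)$ are $$\mathcal S^*_{w_m}[\psi](t)=\int_0^{2\pi}G(x(t;w_m)-y(s;w_m))|x'(t;w_m)|\psi(s)\,\mathrm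 ds,\quad \mathcal K_{w_m}[\psi](t)=\int_0^{2\pi}\frac{\partial G(x(t;w_m)-y(s;w_m))}{\partial\nu_y(s;w_m)}|x'(t;w_m)|\psi(s)\,\mathrm ds.$$ In $\mathcal S^*_{w_m}[\sin(is)]$ and $\mathcal S^*_{w_m}[\cos(is)]$ the argument is the function $s\mapsto\sin(is)$, resp. $s\mapsto\cos(is)$. *)

theory Defs
  imports "HOL-Analysis.Analysis"
begin

record ellipse_params =
  semi_major :: real
  semi_minor :: real
  rot_angle :: real
  center1 :: real
  center2 :: real

definition ellipse :: "ellipse_params \<Rightarrow> real \<Rightarrow> real^2" where
  "ellipse w t =
     (vector [vector [cos (rot_angle w), - sin (rot_angle w)],
              vector [sin (rot_angle w), cos (rot_angle w)]] :: real^2^2)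
       *v vector [semi_major w * cos t, semi_minor w * sin t]
     + vector [center1 w, center2 w]"

definition focal :: "ellipse_params \<Rightarrow> real" where
  "focal w = sqrt ((semi_major w)\<^sup>2 - (semi_minor w)\<^sup>2)"

definition rho :: "ellipse_params \<Rightarrow> real" where
  "rho w = ln ((semi_major w + semi_minor w) / focal w)"

definition Xi :: "ellipse_params \<Rightarrow> real \<Rightarrow> real" where
  "Xi w t = focal w * sqrt ((sinh (rho w))\<^sup>2 + (sin t)\<^sup>2)"

definition tangent :: "ellipse_params \<Rightarrow> real \<Rightarrow> real^2" where
  "tangent w t = vector_derivative (ellipse w) (at t)"

text \<open>The curve runs counterclockwise, so the outward unit normal is the unit tangent turned
  clockwise by a right angle; lemma \<open>ellipse_normal_outward\<close> below confirms the orientation.\<close>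

definition ellipse_normal :: "ellipse_params \<Rightarrow> real \<Rightarrow> real^2" where
  "ellipse_normal w t =
     (1 / norm (tangent w t)) *\<^sub>R vector [tangent w t $ 2, - (tangent w t $ 1)]"

definition G :: "real^2 \<Rightarrow> real" where
  "G z = 1 / (2 * pi) * ln (norm z)"

definition dG_normal_y :: "ellipse_params \<Rightarrow> real \<Rightarrow> real \<Rightarrow> real" where
  "dG_normal_y w t s =
     frechet_derivative (\<lambda>y. G (ellipse w t - y)) (at (ellipse w s)) (ellipse_normal w s)"

text \<open>Both integrands have a meaningless default value at the single point \<open>s = t\<close>, which is
  a null set. Elements of $L^2([0,2\pi),\mathbf{C})$ are represented by Borel functions.\<close>

definition S_adj_integrand :: "ellipse_params \<Rightarrow> (real \<Rightarrow> complex) \<Rightarrow> real \<Rightarrow> real \<Rightarrow> complex" where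
  "S_adj_integrand w \<psi> t s =
     of_real (G (ellipse w t - ellipse w s) * norm (tangent w t)) * \<psi> s"

definition S_adj :: "ellipse_params \<Rightarrow> (real \<Rightarrow> complex) \<Rightarrow> real \<Rightarrow> complex" where
  "S_adj w \<psi> t = (LINT s:{0..<2*pi}|lborel. S_adj_integrand w \<psi> t s)"

definition K_integrand :: "ellipse_params \<Rightarrow> (real \<Rightarrow> complex) \<Rightarrow> real \<Rightarrow> real \<Rightarrow> complex" where
  "K_integrand w \<psi> t s = of_real (dG_normal_y w t s * norm (tangent w t)) * \<psi> s"

definition K_op :: "ellipse_params \<Rightarrow> (real \<Rightarrow> complex) \<Rightarrow> real \<Rightarrow> complex" where
  "K_op w \<psi> t = (LINT s:{0..<2*pi}|lborel. K_integrand w \<psi> t s)"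

definition L2 :: "(real \<Rightarrow> complex) set" where
  "L2 = {\<psi>. set_borel_measurable lborel {0..<2*pi} \<psi> \<and>
             set_integrable lborel {0..<2*pi} (\<lambda>t. (cmod (\<psi> t))\<^sup>2)}"

definition L2_eigenpair ::
    "((real \<Rightarrow> complex) \<Rightarrow> real \<Rightarrow> complex) \<Rightarrow> complex \<Rightarrow> (real \<Rightarrow> complex) \<Rightarrow> bool" where
  "L2_eigenpair T l \<psi> \<longleftrightarrow> \<psi> \<in> L2 \<and>
     \<not> (AE t in lborel. t \<in> {0..<2*pi} \<longrightarrow> \<psi> t = 0) \<and>
     (AE t in lborel. t \<in> {0..<2*pi} \<longrightarrow> T \<psi> t = l * \<psi> t)"

definition alpha :: "ellipse_params \<Rightarrow> nat \<Rightarrow> real" where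
  "alpha w i = 1 / 2 * exp (- 2 * real i * rho w)"

definition q_s :: "ellipse_params \<Rightarrow> nat \<Rightarrow> real \<Rightarrow> complex" where
  "q_s w i t = of_real (sin (real i * t) * Xi w t)"

definition q_c :: "ellipse_params \<Rightarrow> nat \<Rightarrow> real \<Rightarrow> complex" where
  "q_c w i t = of_real (cos (real i * t) * Xi w t)"

lemma ellipse_nth:
  "ellipse w t $ 1 = cos (rot_angle w) * (semi_major w * cos t)
     - sin (rot_angle w) * (semi_minor w * sin t) + center1 w"
  "ellipse w t $ 2 = sin (rot_angle w) * (semi_major w * cos t)
     + cos (rot_angle w) * (semi_minor w * sin t) + center2 w"
  by (simp_all add: ellipse_def matrix_vector_mult_def sum_2)

lemma tangent_eq:
  "tangent w t = vector [- cos (rot_angle w) * (semi_major w * sin t)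
       - sin (rot_angle w) * (semi_minor w * cos t),
     - sin (rot_angle w) * (semi_major w * sin t)
       + cos (rot_angle w) * (semi_minor w * cos t)]" (is "_ = ?v")
proof -
  have "(ellipse w has_vector_derivative ?v) (at t)"
    unfolding has_vector_derivative_def
    by (rule has_derivative_componentwise_within[THEN iffD2])
       (auto simp: Basis_vec_def inner_axis ellipse_nth forall_2 algebra_simps
         intro!: derivative_eq_intros)
  then show ?thesis
    by (simp add: tangent_def vector_derivative_at)
qed

lemma norm_tangent_sq:
  "(norm (tangent w t))\<^sup>2 = (semi_major w * sin t)\<^sup>2 + (semi_minor w * cos t)\<^sup>2"
proof -
  have "(norm (tangent w t))\<^sup>2 = ((sin (rot_angle w))\<^sup>2 + (cos (rot_angle w))\<^sup>2)
      * ((semi_major w * sin t)\<^sup>2 + (semi_minor w * cos t)\<^sup>2)"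
    unfolding power2_norm_eq_inner inner_vec_def tangent_eq sum_2 vector_2 inner_real_def
    by algebra
  then show ?thesis by simp
qed

lemma norm_tangent_eq_Xi:
  assumes ab: "semi_major w > semi_minor w" "semi_minor w > 0"
  shows "norm (tangent w t) = Xi w t"
proof -
  let ?a = "semi_major w" and ?b = "semi_minor w"
  have csq: "?b\<^sup>2 < ?a\<^sup>2" using ab by (intro power_strict_mono) auto
  then have c: "focal w > 0" and c2: "(focal w)\<^sup>2 = ?a\<^sup>2 - ?b\<^sup>2"
    by (auto simp: focal_def)
  have "exp (rho w) = (?a + ?b) / focal w" using ab c by (simp add: rho_def)
  moreover have "exp (- rho w) = (?a - ?b) / focal w"
  proof -
    have "exp (- rho w) = focal w / (?a + ?b)" using calculation by (simp add: exp_minus)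
    also have "\<dots> = (?a - ?b) / focal w"
      using ab c c2 by (simp add: frac_eq_eq power2_eq_square algebra_simps)
    finally show ?thesis .
  qed
  ultimately have "focal w * sinh (rho w) = ?b"
    using c by (simp add: sinh_field_def field_simps)
  then have "?b\<^sup>2 = (focal w)\<^sup>2 * (sinh (rho w))\<^sup>2" by (metis power_mult_distrib)
  then have "(Xi w t)\<^sup>2 = ?b\<^sup>2 + (?a\<^sup>2 - ?b\<^sup>2) * (sin t)\<^sup>2"
    by (simp add: Xi_def power_mult_distrib distrib_left c2)
  also have "\<dots> = (norm (tangent w t))\<^sup>2"
    unfolding norm_tangent_sq by (simp add: power_mult_distrib cos_squared_eq algebra_simps)
  finally have "(Xi w t)\<^sup>2 = (norm (tangent w t))\<^sup>2" .
  moreover have "Xi w t \<ge> 0" using c by (simp add: Xi_def)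
  ultimately show ?thesis by (metis norm_ge_zero power2_eq_iff_nonneg)
qed

lemma ellipse_normal_outward:
  assumes ab: "semi_major w > semi_minor w" "semi_minor w > 0"
  shows "norm (ellipse_normal w t) = 1"
    and "ellipse_normal w t \<bullet> tangent w t = 0"
    and "(ellipse w s - ellipse w t) \<bullet> ellipse_normal w t \<le> 0"
proof -
  let ?a = "semi_major w" and ?b = "semi_minor w" and ?n = "norm (tangent w t)"
  have "sin t \<noteq> 0 \<or> cos t \<noteq> 0" using sin_cos_squared_add[of t] by force
  then have "?n\<^sup>2 > 0"
    unfolding norm_tangent_sq using ab by (auto simp: sum_power2_gt_zero_iff)
  then have n: "?n > 0" by simp
  have "norm (vector [tangent w t $ 2, - (tangent w t $ 1)] :: real^2) = ?n"
    by (simp add: norm_vec_def L2_set_def sum_2 add.commute)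
  then show "norm (ellipse_normal w t) = 1" using n by (simp add: ellipse_normal_def)
  show "ellipse_normal w t \<bullet> tangent w t = 0"
    by (simp add: ellipse_normal_def inner_vec_def sum_2)
  have "(ellipse w s - ellipse w t) \<bullet> ellipse_normal w t
      = ((ellipse w s $ 1 - ellipse w t $ 1) * tangent w t $ 2
         - (ellipse w s $ 2 - ellipse w t $ 2) * tangent w t $ 1) / ?n"
    by (simp add: ellipse_normal_def inner_vec_def sum_2 diff_divide_distrib)
  also have "\<dots> = ((sin (rot_angle w))\<^sup>2 + (cos (rot_angle w))\<^sup>2) * (?a * ?b)
        * (cos s * cos t + sin s * sin t - ((sin t)\<^sup>2 + (cos t)\<^sup>2)) / ?n"
    unfolding ellipse_nth tangent_eq[of w t, THEN arg_cong[where f="\<lambda>v. v $ 1"]]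
      tangent_eq[of w t, THEN arg_cong[where f="\<lambda>v. v $ 2"]] vector_2
    by (rule arg_cong[where f="\<lambda>x. x / ?n"]) algebra
  also have "\<dots> = ?a * ?b * (cos (s - t) - 1) / ?n" by (simp add: cos_diff)
  also have "\<dots> \<le> 0" using ab n by (simp add: divide_le_0_iff mult_le_0_iff)
  finally show "(ellipse w s - ellipse w t) \<bullet> ellipse_normal w t \<le> 0" .
qed

end

theory Submission
  imports Defs
begin

text \<open>Let \<open>k = (a - b) / (a + b) = exp (- 2 \<rho>)\<close>. Elementary trigonometry factorises the chords of the
  ellipse as
  \<open>|x(t) - x(s)|\<^sup>2 = ((a + b) / 2)\<^sup>2 (2 - 2 cos (s - t)) (1 - 2 k cos (s + t) + k\<^sup>2)\<close>
  (lemma \<open>norm_chord_sq\<close>). The logarithm therefore splits into a constant, the kernel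
  \<open>ln |1 - e\<^sup>i\<^sup>u|\<close> in \<open>u = s - t\<close>, and the kernel \<open>ln |1 - k e\<^sup>i\<^sup>u|\<close> in \<open>u = s + t\<close> (\<open>G_chord\<close>). Likewise
  the normal derivative of \<open>G\<close>, multiplied by the arc length density, is a multiple of the Poisson
  kernel of radius \<open>k\<close> in \<open>s + t\<close> (\<open>dG_normal_y_eq\<close>); the density \<open>\<Xi>\<close> is the weight of the
  eigenfunctions. Even periodic kernels in \<open>s - t\<close> and \<open>s + t\<close> map the exponential of
  frequency \<open>m\<close> in \<open>s\<close> to a multiple of the exponential of frequency \<open>m\<close>, respectively \<open>- m\<close>, in \<open>t\<close>, and
  the multiple is read off the Fourier series
  \<open>ln |1 - k e\<^sup>i\<^sup>u| = - \<Sum> k\<^sup>n cos (n u) / n\<close> and \<open>1 + 2 \<Sum> k\<^sup>n cos (n u)\<close>. Real and imaginary parts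
  give the formulas for cosines and sines.

  For \<open>k < 1\<close> the series converge absolutely and may be integrated term by term
  (\<open>has_bochner_integral_cos_series_cis\<close>). The only singular kernel is the logarithmic one at
  radius \<open>1\<close>, which is reached from smaller radii by monotone and dominated convergence
  (\<open>log_kernel_integral\<close>).\<close>

section \<open>Integration over one period\<close>

text \<open>With a finite measure on \<open>[0, 2\<pi>)\<close> in place of set integrals, the theorems on termwise integration
  and on monotone and dominated convergence apply as they stand.\<close>

definition period_measure :: "real measure" where
  "period_measure = restrict_space lborel {0..<2 * pi}"

lemma space_period_measure [simp]: "space period_measure = {0..<2 * pi}"
  by (simp add: period_measure_def space_restrict_space)

lemma measurable_period_measure:
  "f \<in> borel_measurable borel \<Longrightarrow> f \<in> borel_measurable period_measure"
  by (simp add: period_measure_def measurable_restrict_space1)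

lemma sets_period_measure_singleton: "x \<in> {0..<2 * pi} \<Longrightarrow> {x} \<in> sets period_measure"
  by (simp add: period_measure_def sets_restrict_space_iff)

lemma emeasure_period_measure_singleton: "emeasure period_measure {x} = 0"
proof (cases "x \<in> {0..<2 * pi}")
  case True
  then show ?thesis by (simp add: period_measure_def emeasure_restrict_space)
next
  case False
  then have "{x} \<notin> sets period_measure"
    using sets.sets_into_space[of "{x}" period_measure] by auto
  then show ?thesis by (rule emeasure_notin_sets)
qed

interpretation period_measure: finite_measure period_measure
  by (rule finite_measureI) (simp add: period_measure_def emeasure_restrict_space)

lemma measure_period_measure: "measure period_measure {0..<2 * pi} = 2 * pi"
  by (simp add: period_measure_def measure_restrict_space)

lemma AE_period_measure_countable:
  assumes "countable X"
  shows "AE s in period_measure. s \<notin> X"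
proof -
  have "AE s in lborel. s \<notin> X"
    using assms by (intro AE_not_in countable_imp_null_set_lborel)
  then show ?thesis
    unfolding period_measure_def by (subst AE_restrict_space_iff) auto
qed

lemma has_bochner_integral_period_measure_iff:
  fixes f :: "real \<Rightarrow> 'a :: {banach, second_countable_topology}"
  shows "has_bochner_integral period_measure f x \<longleftrightarrow>
    set_integrable lborel {0..<2 * pi} f \<and> (LINT s:{0..<2 * pi}|lborel. f s) = x"
  by (simp add: has_bochner_integral_iff period_measure_def integrable_restrict_space
      integral_restrict_space set_integrable_def set_lebesgue_integral_def)

text \<open>Both operator kernels are defined on the diagonal \<open>s = t\<close> only by convention, and their closed
  forms hold off it. This lemma transfers integrals, measurability included, past that point.\<close>

lemma has_bochner_integral_period_measure_except:
  fixes f :: "real \<Rightarrow> 'a :: {banach, second_countable_topology}"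
  assumes "has_bochner_integral period_measure f x"
    and "t \<in> {0..<2 * pi}" and "\<And>s. s \<in> {0..<2 * pi} \<Longrightarrow> s \<noteq> t \<Longrightarrow> g s = f s"
  shows "has_bochner_integral period_measure g x"
  using assms has_bochner_integral_discrete_difference[of "{t}" period_measure g f x]
    sets_period_measure_singleton emeasure_period_measure_singleton by auto

lemma has_bochner_integral_cis:
  "has_bochner_integral period_measure (\<lambda>s. cis (real_of_int j * s)) (if j = 0 then 2 * pi else 0)"
proof (cases "j = 0")
  case True
  have "has_bochner_integral period_measure (\<lambda>s. 1 :: complex) (measure period_measure (space period_measure) *\<^sub>R 1)"
    by (simp add: has_bochner_integral_iff)
  then show ?thesis using True by (simp add: measure_period_measure scaleR_conv_of_real)
next
  case False
  \<comment> \<open>The antiderivative is again periodic, so its increment over the period is zero.\<close>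
  define F where "F = (\<lambda>s. cis (real_of_int j * s) / (\<i> * of_int j))"
  have "has_bochner_integral lborel
      (\<lambda>s. indicator {0..2 * pi} s *\<^sub>R cis (real_of_int j * s)) (F (2 * pi) - F 0)"
  proof (rule has_bochner_integral_FTC_Icc)
    show "(F has_vector_derivative cis (real_of_int j * s)) (at s within {0..2 * pi})" for s
      unfolding F_def has_vector_derivative_def using False
      by (auto intro!: derivative_eq_intros simp: scaleR_conv_of_real field_simps)
  qed (auto intro!: continuous_intros)
  also have "F (2 * pi) - F 0 = 0"
    using cis_multiple_2pi[of "of_int j"] by (simp add: F_def mult_ac)
  finally have "has_bochner_integral lborel
      (\<lambda>s. indicator {0..<2 * pi} s *\<^sub>R cis (real_of_int j * s)) 0"
    by (subst (asm) has_bochner_integral_discrete_difference[of "{2 * pi}" lborel _ "\<lambda>s. indicator {0..<2 * pi} s *\<^sub>R cis (real_of_int j * s)"])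
      (auto simp: indicator_def)
  then show ?thesis
    using False by (simp add: has_bochner_integral_iff period_measure_def
        integrable_restrict_space integral_restrict_space)
qed

text \<open>Orthogonality, with the phase \<open>\<theta>\<close> built in: the kernels depend on \<open>s - t\<close> and on \<open>s + t\<close>, and
  this form covers both, so that no change of variables is needed later.\<close>

lemma has_bochner_integral_cos_cis:
  "has_bochner_integral period_measure (\<lambda>s. of_real (cos (real n * (s + \<theta>))) * cis (real m * s))
     (if n = m then (if m = 0 then 2 else 1) * (of_real pi * cis (- real m * \<theta>)) else 0)"
proof -
  let ?c = "\<lambda>j s. cis (real_of_int j * s)"
  have "has_bochner_integral period_measure
      (\<lambda>s. (cis (real n * \<theta>) / 2) * ?c (int m + int n) s
         + (cis (- real n * \<theta>) / 2) * ?c (int m - int n) s)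
      ((cis (real n * \<theta>) / 2) * (if int m + int n = 0 then 2 * pi else 0)
         + (cis (- real n * \<theta>) / 2) * (if int m - int n = 0 then 2 * pi else 0))"
    using has_bochner_integral_cis
    by (intro has_bochner_integral_add has_bochner_integral_mult_right) (metis+)
  moreover have "(cis (real n * \<theta>) / 2) * ?c (int m + int n) s
         + (cis (- real n * \<theta>) / 2) * ?c (int m - int n) s
       = of_real (cos (real n * (s + \<theta>))) * cis (real m * s)" for s
  proof -
    have "of_real (cos (real n * (s + \<theta>))) = (cis (real n * (s + \<theta>)) + cis (- (real n * (s + \<theta>)))) / 2"
      by (simp add: complex_eq_iff)
    then show ?thesis by (simp add: cis_mult add_divide_distrib distrib_right algebra_simps)
  qed
  ultimately show ?thesis by (auto simp: mult.commute if_distrib cong: if_cong)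
qed

section \<open>Fourier coefficients of cosine series\<close>

text \<open>For absolutely summable coefficients the dominated interchange of sum and integral leaves, by
  orthogonality, only the term of index \<open>m\<close>.\<close>

lemma has_bochner_integral_cos_series_cis:
  fixes c :: "nat \<Rightarrow> real"
  assumes c: "summable (\<lambda>n. \<bar>c n\<bar>)" and f: "\<And>u. (\<lambda>n. c n * cos (real n * u)) sums f u"
  shows "has_bochner_integral period_measure (\<lambda>s. of_real (f (s + \<theta>)) * cis (real m * s))
    ((if m = 0 then 2 else 1) * (of_real (pi * c m) * cis (- real m * \<theta>)))"
proof -
  define g where "g n s = of_real (c n) * (of_real (cos (real n * (s + \<theta>))) * cis (real m * s))" for n s
  define v where "v = (if m = 0 then 2 else 1) * (of_real (pi * c m) * cis (- real m * \<theta>))"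
  have g: "has_bochner_integral period_measure (g n) (if n = m then v else 0)" for n
    using has_bochner_integral_mult_right[OF has_bochner_integral_cos_cis, of "of_real (c n)" n \<theta> m]
    by (cases "n = m") (simp_all add: g_def[abs_def] v_def mult_ac)
  then have int: "integrable period_measure (g n)" for n
    by (auto simp: has_bochner_integral_iff)
  have bound: "norm (g n s) \<le> \<bar>c n\<bar>" for n s
    by (simp add: g_def norm_mult mult_left_le)
  have sm: "summable (\<lambda>n. norm (g n s))" for s
    by (rule summable_comparison_test'[OF c]) (simp add: bound)
  have "(\<integral>s. norm (g n s) \<partial>period_measure) \<le> 2 * pi * \<bar>c n\<bar>" for n
  proof -
    have "(\<integral>s. norm (g n s) \<partial>period_measure) \<le> (\<integral>s. \<bar>c n\<bar> \<partial>period_measure)"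
      using int bound by (intro integral_mono) auto
    then show ?thesis by (simp add: measure_period_measure)
  qed
  then have sm2: "summable (\<lambda>n. \<integral>s. norm (g n s) \<partial>period_measure)"
    by (intro summable_comparison_test'[OF summable_mult[OF c, of "2 * pi"]]) simp
  have "(\<lambda>n. integral\<^sup>L period_measure (g n)) = (\<lambda>n. if n = m then v else 0)"
    using g by (auto simp: has_bochner_integral_iff)
  moreover have "(\<lambda>n. if n = m then v else 0) sums v"
    by (rule sums_single)
  ultimately have "has_bochner_integral period_measure (\<lambda>s. \<Sum>n. g n s) v"
    using integrable_suminf[of period_measure g, OF int _ sm2]
      integral_suminf[of period_measure g, OF int _ sm2] sm
    by (simp add: has_bochner_integral_iff sums_iff)
  moreover have "(\<Sum>n. g n s) = of_real (f (s + \<theta>)) * cis (real m * s)" for s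
  proof -
    have "(\<lambda>n. of_real (c n * cos (real n * (s + \<theta>))) * cis (real m * s))
        sums (of_real (f (s + \<theta>)) * cis (real m * s))"
      by (intro sums_mult2 sums_of_real f)
    then show ?thesis by (simp add: g_def sums_iff mult.assoc)
  qed
  ultimately show ?thesis by (simp add: v_def)
qed

section \<open>Logarithmic and Poisson kernels\<close>

text \<open>With \<open>z = k e\<^sup>i\<^sup>u\<close> this is \<open>ln |1 - z|\<close>; for \<open>k = 1\<close> it is the singular kernel \<open>ln |2 sin (u / 2)|\<close>.\<close>

definition log_kernel :: "real \<Rightarrow> real \<Rightarrow> real" where
  "log_kernel k u = ln (1 - 2 * k * cos u + k\<^sup>2) / 2"

text \<open>With \<open>z = k e\<^sup>i\<^sup>u\<close> this is the real part of \<open>(1 + z) / (1 - z)\<close>.\<close>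

definition poisson_kernel :: "real \<Rightarrow> real \<Rightarrow> real" where
  "poisson_kernel k u = (1 - k\<^sup>2) / (1 - 2 * k * cos u + k\<^sup>2)"

lemma norm_one_minus_cis_sq: "(norm (1 - of_real k * cis u))\<^sup>2 = 1 - 2 * k * cos u + k\<^sup>2"
proof -
  have "(norm (1 - of_real k * cis u))\<^sup>2 = (1 - k * cos u)\<^sup>2 + (k * sin u)\<^sup>2"
    by (simp add: cmod_power2)
  also have "\<dots> = 1 - 2 * k * cos u + k\<^sup>2 * ((sin u)\<^sup>2 + (cos u)\<^sup>2)"
    by algebra
  finally show ?thesis by simp
qed

text \<open>The real part of the power series of \<open>ln (1 - z)\<close>. The summand of index \<open>0\<close> is \<open>1 / 0 = 0\<close>,
  which is the correct constant term.\<close>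

lemma log_kernel_sums:
  fixes k :: real
  assumes "0 \<le> k" "k < 1"
  shows "(\<lambda>n. - (k ^ n / real n) * cos (real n * u)) sums log_kernel k u"
proof -
  let ?z = "of_real k * cis u"
  have z: "norm ?z < 1" using assms by (simp add: norm_mult)
  then have nz: "1 - ?z \<noteq> 0" by auto
  have "(\<lambda>n. - (?z ^ n) / of_nat n) sums ln (1 - ?z)"
    using Ln_series'[of "- ?z"] z by simp
  then have "(\<lambda>n. Re (- (?z ^ n) / of_nat n)) sums Re (ln (1 - ?z))" by (rule sums_Re)
  also have "(\<lambda>n. Re (- (?z ^ n) / of_nat n)) = (\<lambda>n. - (k ^ n / real n) * cos (real n * u))"
    by (simp add: power_mult_distrib cos_n_Re_cis_pow_n flip: of_real_power)
  also have "Re (ln (1 - ?z)) = ln ((norm (1 - ?z))\<^sup>2) / 2"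
    using nz by (simp add: ln_realpow)
  finally show ?thesis unfolding norm_one_minus_cis_sq log_kernel_def .
qed

text \<open>The real part of the geometric series, in the form \<open>2 / (1 - z) - 1\<close>.\<close>

lemma poisson_kernel_sums:
  fixes k :: real
  assumes "0 \<le> k" "k < 1"
  shows "(\<lambda>n. (if n = 0 then 1 else 2 * k ^ n) * cos (real n * u)) sums
     poisson_kernel k u"
proof -
  let ?z = "of_real k * cis u"
  have z: "norm ?z < 1" using assms by (simp add: norm_mult)
  then have nz: "1 - ?z \<noteq> 0" by auto
  have "(\<lambda>n. 2 * ?z ^ n - (if n = 0 then 1 else 0)) sums (2 * (1 / (1 - ?z)) - 1)"
    by (intro sums_diff sums_mult geometric_sums z sums_single)
  then have "(\<lambda>n. Re (2 * ?z ^ n - (if n = 0 then 1 else 0))) sums Re (2 * (1 / (1 - ?z)) - 1)"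
    by (rule sums_Re)
  also have "(\<lambda>n. Re (2 * ?z ^ n - (if n = 0 then 1 else 0)))
      = (\<lambda>n. (if n = 0 then 1 else 2 * k ^ n) * cos (real n * u))"
    by (auto simp: power_mult_distrib cos_n_Re_cis_pow_n simp flip: of_real_power)
  also have "Re (2 * (1 / (1 - ?z)) - 1) = 2 * (1 - k * cos u) / (norm (1 - ?z))\<^sup>2 - 1"
    by (simp add: Re_divide cmod_power2)
  also have "\<dots> = poisson_kernel k u"
  proof -
    have "(norm (1 - ?z))\<^sup>2 \<noteq> 0" using nz by simp
    then show ?thesis unfolding norm_one_minus_cis_sq poisson_kernel_def by (simp add: field_simps)
  qed
  finally show ?thesis .
qed

lemma measurable_log_kernel [measurable]: "log_kernel k \<in> borel_measurable borel"
  unfolding log_kernel_def[abs_def] by measurable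

text \<open>For \<open>m = 0\<close> the convention \<open>x / 0 = 0\<close> again gives the true value: the mean of the kernel is zero.\<close>

lemma log_kernel_integral_interior:
  assumes "0 \<le> k" "k < 1"
  shows "has_bochner_integral period_measure
    (\<lambda>s. of_real (log_kernel k (s + \<theta>)) * cis (real m * s))
    (of_real (- (pi * k ^ m / real m)) * cis (- real m * \<theta>))"
proof -
  have "summable (\<lambda>n. k ^ n)" using assms by (intro summable_geometric) auto
  then have "summable (\<lambda>n. \<bar>- (k ^ n / real n)\<bar>)"
  proof (rule summable_comparison_test')
    show "norm \<bar>- (k ^ n / real n)\<bar> \<le> k ^ n" for n
      using assms by (cases "n = 0") (auto simp: divide_le_eq mult_left_le_one_le mult_le_cancel_left1)
  qed
  from has_bochner_integral_cos_series_cis[OF this log_kernel_sums[OF assms], of \<theta> m]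
  show ?thesis by (cases "m = 0") auto
qed

lemma poisson_kernel_integral:
  assumes "0 \<le> k" "k < 1"
  shows "has_bochner_integral period_measure
    (\<lambda>s. of_real (poisson_kernel k (s + \<theta>)) * cis (real m * s))
    (of_real (2 * pi * k ^ m) * cis (- real m * \<theta>))"
proof -
  have "summable (\<lambda>n. 2 * k ^ n)" using assms by (intro summable_mult summable_geometric) auto
  then have "summable (\<lambda>n. \<bar>if n = 0 then 1 else 2 * k ^ n\<bar>)"
    by (rule summable_comparison_test') (use assms in auto)
  note has_bochner_integral_cos_series_cis[OF this poisson_kernel_sums[OF assms], of \<theta> m]
  also have "(if m = 0 then 2 else 1) * (complex_of_real (pi * (if m = 0 then 1 else 2 * k ^ m)) *
      cis (- real m * \<theta>)) = of_real (2 * pi * k ^ m) * cis (- real m * \<theta>)"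
    by simp
  finally show ?thesis .
qed

lemma kernel_denominator_pos:
  fixes k :: real
  assumes "0 \<le> k" "cos u \<noteq> 1"
  shows "0 < 1 - 2 * k * cos u + k\<^sup>2"
proof -
  have "1 - 2 * k * cos u + k\<^sup>2 = (1 - k)\<^sup>2 + 2 * k * (1 - cos u)"
    by (simp add: power2_eq_square algebra_simps)
  moreover have "0 < 1 - cos u" using assms cos_le_one[of u] by linarith
  ultimately show ?thesis
    using assms by (cases "k = 0") (auto intro!: add_nonneg_pos)
qed

text \<open>The two terms together are \<open>ln ((1 + k) / |1 - z|)\<close>, where \<open>1 + k\<close> is the maximum of \<open>|1 - z|\<close> over
  the circle of radius \<open>k\<close>. Normalising by the maximum turns the logarithmic kernels into a
  nonnegative family that increases with the radius, which the kernels themselves do not.\<close>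

lemma log_ratio_mono:
  assumes k: "0 \<le> k" "k \<le> l" "l \<le> 1" and u: "cos u \<noteq> 1"
  shows "ln (1 + k) - log_kernel k u \<le> ln (1 + l) - log_kernel l u"
proof -
  let ?D = "\<lambda>k. 1 - 2 * k * cos u + k\<^sup>2"
  have D: "0 < ?D k" "0 < ?D l" using assms by (auto intro!: kernel_denominator_pos)
  \<comment> \<open>The comparison of the two quotients, cleared of denominators, factorises completely.\<close>
  have "(1 + l)\<^sup>2 * ?D k - (1 + k)\<^sup>2 * ?D l = 2 * (1 + cos u) * ((l - k) * (1 - k * l))"
    by algebra
  moreover have "0 \<le> 2 * (1 + cos u) * ((l - k) * (1 - k * l))"
  proof -
    have "0 \<le> 1 + cos u" using cos_ge_minus_one[of u] by linarith
    then show ?thesis using k by (intro mult_nonneg_nonneg) (auto intro: mult_le_one)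
  qed
  ultimately have "(1 + k)\<^sup>2 * ?D l \<le> (1 + l)\<^sup>2 * ?D k" by linarith
  then have "ln ((1 + k)\<^sup>2 * ?D l) \<le> ln ((1 + l)\<^sup>2 * ?D k)"
    using D k by (subst ln_le_cancel_iff) auto
  then have "2 * ln (1 + k) + ln (?D l) \<le> 2 * ln (1 + l) + ln (?D k)"
    using D k by (simp add: ln_mult ln_realpow)
  then show ?thesis by (simp add: log_kernel_def)
qed

lemma AE_cos_noteq_one: "AE s in period_measure. cos (s + \<theta>) \<noteq> 1"
proof -
  have "countable (range (\<lambda>n. of_int n * 2 * pi - \<theta>))" by simp
  then have "AE s in period_measure. s \<notin> range (\<lambda>n. of_int n * 2 * pi - \<theta>)"
    by (rule AE_period_measure_countable)
  then show ?thesis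
  proof eventually_elim
    case (elim s)
    show ?case
    proof
      assume "cos (s + \<theta>) = 1"
      then obtain n :: int where "s + \<theta> = of_int n * 2 * pi" unfolding cos_one_2pi_int by blast
      then have "s = of_int n * 2 * pi - \<theta>" by simp
      then show False using elim by blast
    qed
  qed
qed

text \<open>The formula persists at \<open>k = 1\<close>, where the series is no longer absolutely summable and the kernel
  is unbounded. The normalised kernels of \<open>log_ratio_mono\<close> increase as the radius tends to \<open>1\<close>, and
  their integrals \<open>2\<pi> ln (1 + k)\<close> stay bounded because the kernels have mean zero. Monotone
  convergence thus shows that the limit kernel is integrable without any estimate of the
  singularity, and this limit plus \<open>ln 2\<close> dominates the kernels, so that dominated convergence
  yields the coefficients at every frequency.\<close>

lemma log_kernel_integral:
  assumes "0 \<le> k" "k \<le> 1"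
  shows "has_bochner_integral period_measure
    (\<lambda>s. of_real (log_kernel k (s + \<theta>)) * cis (real m * s))
    (of_real (- (pi * k ^ m / real m)) * cis (- real m * \<theta>))"
proof (cases "k < 1")
  case True
  with assms show ?thesis by (intro log_kernel_integral_interior)
next
  case False
  with assms have k: "k = 1" by simp
  define \<kappa> where "\<kappa> j = 1 - inverse (real (Suc j))" for j
  have \<kappa>: "0 \<le> \<kappa> j" "\<kappa> j < 1" for j by (auto simp: \<kappa>_def field_simps)
  have \<kappa>_mono: "\<kappa> i \<le> \<kappa> j" if "i \<le> j" for i j using that by (simp add: \<kappa>_def field_simps)
  have \<kappa>_lim: "\<kappa> \<longlonglongrightarrow> 1"
    unfolding \<kappa>_def[abs_def] using tendsto_diff[OF tendsto_const LIMSEQ_inverse_real_of_nat, of 1] by simp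
  have lim: "(\<lambda>j. log_kernel (\<kappa> j) u) \<longlonglongrightarrow> log_kernel 1 u" if "cos u \<noteq> 1" for u
    unfolding log_kernel_def using kernel_denominator_pos[of 1 u] that
    by (intro tendsto_divide tendsto_ln tendsto_add tendsto_diff tendsto_mult tendsto_power
        tendsto_const \<kappa>_lim) auto
  define h where "h k s = ln (1 + k) - log_kernel k (s + \<theta>)" for k s
  \<comment> \<open>The frequency \<open>m = 0\<close> gives mean zero for the kernel, so only the constant is integrated.\<close>
  have int_h: "has_bochner_integral period_measure (h (\<kappa> j)) (2 * pi * ln (1 + \<kappa> j))" for j
  proof -
    have "has_bochner_integral period_measure (\<lambda>s. Re (of_real (log_kernel (\<kappa> j) (s + \<theta>)) * cis (real 0 * s)))
        (Re (of_real (- (pi * \<kappa> j ^ 0 / real 0)) * cis (- real 0 * \<theta>)))"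
      by (intro has_bochner_integral_bounded_linear[OF bounded_linear_Re] log_kernel_integral_interior \<kappa>)
    then have "has_bochner_integral period_measure (\<lambda>s. log_kernel (\<kappa> j) (s + \<theta>)) 0" by simp
    moreover have "has_bochner_integral period_measure (\<lambda>s. ln (1 + \<kappa> j)) (2 * pi * ln (1 + \<kappa> j))"
      by (simp add: has_bochner_integral_iff measure_period_measure)
    ultimately have "has_bochner_integral period_measure (h (\<kappa> j)) (2 * pi * ln (1 + \<kappa> j) - 0)"
      unfolding h_def[abs_def] by (intro has_bochner_integral_diff)
    then show ?thesis by simp
  qed
  have h_mono: "AE s in period_measure. mono (\<lambda>j. h (\<kappa> j) s)"
    using AE_cos_noteq_one[of \<theta>]
  proof eventually_elim
    case (elim s)
    have "h (\<kappa> i) s \<le> h (\<kappa> j) s" if "i \<le> j" for i j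
      unfolding h_def using \<kappa>[of i] \<kappa>[of j] \<kappa>_mono[OF that] elim by (intro log_ratio_mono) auto
    then show ?case by (simp add: mono_def)
  qed
  have h_lim: "AE s in period_measure. (\<lambda>j. h (\<kappa> j) s) \<longlonglongrightarrow> h 1 s"
    using AE_cos_noteq_one[of \<theta>]
  proof eventually_elim
    case (elim s)
    then show ?case unfolding h_def
      by (intro tendsto_diff tendsto_ln tendsto_add tendsto_const \<kappa>_lim lim) auto
  qed
  have int_lim: "(\<lambda>j. integral\<^sup>L period_measure (h (\<kappa> j))) \<longlonglongrightarrow> 2 * pi * ln (1 + 1)"
  proof -
    have "(\<lambda>j. integral\<^sup>L period_measure (h (\<kappa> j))) = (\<lambda>j. 2 * pi * ln (1 + \<kappa> j))"
      using int_h by (auto simp: has_bochner_integral_iff)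
    moreover have "(\<lambda>j. 2 * pi * ln (1 + \<kappa> j)) \<longlonglongrightarrow> 2 * pi * ln (1 + 1)"
      by (intro tendsto_mult tendsto_ln tendsto_add tendsto_const \<kappa>_lim) simp
    ultimately show ?thesis by (simp only:)
  qed
  have h_meas: "h 1 \<in> borel_measurable period_measure"
    unfolding h_def[abs_def] by (rule measurable_period_measure) measurable
  have h_int: "integrable period_measure (h (\<kappa> j))" for j
    using int_h by (auto simp: has_bochner_integral_iff)
  have "integrable period_measure (h 1)"
    by (rule integrable_monotone_convergence[OF h_int h_mono h_lim int_lim h_meas])
  then have int_bound: "integrable period_measure (\<lambda>s. h 1 s + ln 2)" by simp
  let ?f = "\<lambda>k s. complex_of_real (log_kernel k (s + \<theta>)) * cis (real m * s)"
  have f_meas: "?f k \<in> borel_measurable period_measure" for k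
  proof -
    have [measurable]: "(\<lambda>s. cis (real m * s)) \<in> borel_measurable borel"
      by (intro borel_measurable_continuous_onI continuous_intros)
    then show ?thesis by (intro measurable_period_measure) measurable
  qed
  have f_lim: "AE s in period_measure. (\<lambda>j. ?f (\<kappa> j) s) \<longlonglongrightarrow> ?f 1 s"
    using AE_cos_noteq_one[of \<theta>]
  proof eventually_elim
    case (elim s)
    then show ?case by (intro tendsto_mult tendsto_of_real tendsto_const lim)
  qed
  have f_bound: "AE s in period_measure. norm (?f (\<kappa> j) s) \<le> h 1 s + ln 2" for j
    using AE_cos_noteq_one[of \<theta>]
  proof eventually_elim
    case (elim s)
    have "0 \<le> h (\<kappa> j) s" "h (\<kappa> j) s \<le> h 1 s"
      using log_ratio_mono[of 0 "\<kappa> j" "s + \<theta>"] log_ratio_mono[of "\<kappa> j" 1 "s + \<theta>"] elim \<kappa>[of j]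
      by (auto simp: h_def log_kernel_def)
    moreover have "0 \<le> ln (1 + \<kappa> j)" "ln (1 + \<kappa> j) \<le> ln 2"
      using \<kappa>[of j] by auto
    ultimately show ?case by (auto simp: h_def norm_mult)
  qed
  have "integrable period_measure (?f 1)"
    by (rule integrable_dominated_convergence[OF f_meas f_meas int_bound f_lim f_bound])
  moreover have "(\<lambda>j. integral\<^sup>L period_measure (?f (\<kappa> j))) \<longlonglongrightarrow> integral\<^sup>L period_measure (?f 1)"
    by (rule integral_dominated_convergence[OF f_meas f_meas int_bound f_lim f_bound])
  moreover have "(\<lambda>j. integral\<^sup>L period_measure (?f (\<kappa> j)))
      = (\<lambda>j. of_real (- (pi * \<kappa> j ^ m / real m)) * cis (- real m * \<theta>))"
    using log_kernel_integral_interior[OF \<kappa>] by (simp add: has_bochner_integral_iff)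
  moreover have "(\<lambda>j. of_real (- (pi * \<kappa> j ^ m / real m)) * cis (- real m * \<theta>))
      \<longlonglongrightarrow> of_real (- (pi * 1 ^ m / real m)) * cis (- real m * \<theta>)"
    by (cases "m = 0", simp, intro tendsto_mult tendsto_of_real tendsto_minus tendsto_divide
        tendsto_power tendsto_const \<kappa>_lim, simp)
  ultimately show ?thesis
    unfolding k by (auto simp: has_bochner_integral_iff dest: LIMSEQ_unique)
qed

text \<open>The operators are evaluated on \<open>cis\<close>; these two lemmas extract the cosine and the sine.\<close>

lemma has_bochner_integral_of_real_Re:
  assumes "has_bochner_integral M f v"
  shows "has_bochner_integral M (\<lambda>x. complex_of_real (Re (f x))) (of_real (Re v))"
  using has_bochner_integral_bounded_linear[OF bounded_linear_of_real
      has_bochner_integral_bounded_linear[OF bounded_linear_Re assms]] .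

lemma has_bochner_integral_of_real_Im:
  assumes "has_bochner_integral M f v"
  shows "has_bochner_integral M (\<lambda>x. complex_of_real (Im (f x))) (of_real (Im v))"
  using has_bochner_integral_bounded_linear[OF bounded_linear_of_real
      has_bochner_integral_bounded_linear[OF bounded_linear_Im assms]] .

lemma L2_of_real:
  assumes "continuous_on UNIV f"
  shows "(\<lambda>t. complex_of_real (f t)) \<in> L2"
proof -
  have [measurable]: "f \<in> borel_measurable borel" by (intro borel_measurable_continuous_onI assms)
  have "set_integrable lborel {0..2 * pi} (\<lambda>t. (cmod (of_real (f t)))\<^sup>2)"
    unfolding set_integrable_def
    by (intro borel_integrable_compact) (auto intro!: continuous_intros continuous_on_subset[OF assms])
  then have "set_integrable lborel {0..<2 * pi} (\<lambda>t. (cmod (of_real (f t)))\<^sup>2)"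
    by (rule set_integrable_subset) auto
  then show ?thesis
    by (auto simp: L2_def set_borel_measurable_def)
qed

text \<open>An interval where \<open>f\<close> has no zero is what keeps \<open>f\<close> from vanishing almost everywhere.\<close>

lemma L2_eigenpair_of_real:
  assumes f: "continuous_on UNIV f" and \<epsilon>: "0 < \<epsilon>" "\<epsilon> \<le> 2 * pi"
    and nz: "\<And>t. 0 < t \<Longrightarrow> t < \<epsilon> \<Longrightarrow> f t \<noteq> 0"
    and T: "\<And>t. t \<in> {0..<2 * pi} \<Longrightarrow> T (\<lambda>t. of_real (f t)) t = l * of_real (f t)"
  shows "L2_eigenpair T l (\<lambda>t. of_real (f t))"
proof -
  have "\<not> (AE t in lborel. t \<in> {0..<2 * pi} \<longrightarrow> complex_of_real (f t) = 0)"
  proof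
    assume "AE t in lborel. t \<in> {0..<2 * pi} \<longrightarrow> complex_of_real (f t) = 0"
    then have "AE t in lborel. t \<notin> {0<..<\<epsilon>}"
      by eventually_elim (use nz \<epsilon> in force)
    then have "emeasure lborel {0<..<\<epsilon>} = 0"
      by (subst (asm) AE_iff_measurable[of "{0<..<\<epsilon>}"]) auto
    then show False using \<epsilon> by simp
  qed
  then show ?thesis using L2_of_real[OF f] T by (simp add: L2_eigenpair_def)
qed

section \<open>Geometry of the ellipse\<close>

lemma frechet_derivative_G:
  assumes "x \<noteq> y"
  shows "frechet_derivative (\<lambda>y. G (x - y)) (at y) h = (y - x) \<bullet> h / (2 * pi * (norm (x - y))\<^sup>2)"
proof -
  have "((\<lambda>y. norm (x - y)) has_derivative (\<lambda>h. - h \<bullet> sgn (x - y))) (at y)"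
    by (rule has_derivative_compose[OF _ has_derivative_norm])
      (use assms in \<open>auto intro!: derivative_eq_intros\<close>)
  then have "((\<lambda>y. G (x - y)) has_derivative
      (\<lambda>h. 1 / (2 * pi) * (inverse (norm (x - y)) * (- h \<bullet> sgn (x - y))))) (at y)"
    unfolding G_def using assms by (auto intro!: derivative_eq_intros simp: mult_ac)
  then have "frechet_derivative (\<lambda>y. G (x - y)) (at y) h
      = 1 / (2 * pi) * (inverse (norm (x - y)) * (- h \<bullet> sgn (x - y)))"
    by (simp flip: frechet_derivative_at)
  also have "- h \<bullet> sgn (x - y) = - (h \<bullet> (x - y)) / norm (x - y)"
    unfolding sgn_div_norm by (simp add: inverse_eq_divide)
  also have "- (h \<bullet> (x - y)) = (y - x) \<bullet> h"
    by (subst inner_commute) (simp flip: inner_minus_left)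
  finally show ?thesis by (simp add: power2_eq_square inverse_eq_divide mult.assoc)
qed

locale proper_ellipse =
  fixes w :: ellipse_params
  assumes major_greater_minor: "semi_major w > semi_minor w" and minor_pos: "semi_minor w > 0"
begin

abbreviation a :: real where "a \<equiv> semi_major w"
abbreviation b :: real where "b \<equiv> semi_minor w"

text \<open>The constant \<open>k\<close> equals \<open>(a - b) / (a + b)\<close>: up to a similarity, the ellipse is the image of the unit circle
  under \<open>\<zeta> \<mapsto> \<zeta> + k / \<zeta>\<close>.\<close>

definition k :: real where "k = exp (- 2 * rho w)"

lemma focal_sq: "(focal w)\<^sup>2 = a\<^sup>2 - b\<^sup>2" and focal_pos: "focal w > 0"
proof -
  have "b\<^sup>2 < a\<^sup>2" using major_greater_minor minor_pos by (intro power_strict_mono) auto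
  then show "(focal w)\<^sup>2 = a\<^sup>2 - b\<^sup>2" "focal w > 0" by (auto simp: focal_def)
qed

lemma ab_pos: "0 < b" "0 < a" "b < a"
  using major_greater_minor minor_pos by auto

lemma k_eq: "k = (a - b) / (a + b)"
proof -
  have "exp (rho w) = (a + b) / focal w"
    using ab_pos focal_pos by (simp add: rho_def)
  then have "exp (- rho w) = focal w / (a + b)" by (simp add: exp_minus)
  moreover have "k = (exp (- rho w))\<^sup>2" by (simp add: k_def flip: exp_double)
  ultimately have "k = (a\<^sup>2 - b\<^sup>2) / (a + b)\<^sup>2" by (simp add: power_divide focal_sq)
  also have "\<dots> = (a - b) / (a + b)"
    using ab_pos by (simp add: power2_eq_square square_diff_square_factored)
  finally show ?thesis .
qed

lemma k_bounds: "0 \<le> k" "k < 1"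
  using ab_pos by (auto simp: k_eq)

lemma alpha_eq: "alpha w i = k ^ i / 2"
  by (simp add: alpha_def k_def mult_ac flip: exp_of_nat_mult)

lemma rho_plus_ln_focal: "rho w + ln (focal w / 2) = ln ((a + b) / 2)"
  using ab_pos focal_pos by (simp add: rho_def ln_div)

lemma Xi_eq: "norm (tangent w t) = Xi w t"
  by (rule norm_tangent_eq_Xi[OF major_greater_minor minor_pos])

lemma Xi_pos: "Xi w t > 0"
proof -
  have "sinh (rho w) \<noteq> 0"
    using k_bounds by (auto simp: k_def)
  then have "0 < (sinh (rho w))\<^sup>2 + (sin t)\<^sup>2" by (simp add: add_pos_nonneg)
  then show ?thesis using focal_pos by (simp add: Xi_def)
qed

lemma continuous_on_Xi: "continuous_on S (Xi w)"
  unfolding Xi_def by (intro continuous_intros)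

text \<open>The factorisation behind all formulas. In the coordinate \<open>\<zeta> = e\<^sup>i\<^sup>t\<close>, \<open>\<eta> = e\<^sup>i\<^sup>s\<close> a chord of the
  unrotated ellipse is \<open>(a + b) / 2\<close> times \<open>(\<zeta> - \<eta>) (1 - k / (\<zeta> \<eta>))\<close>: the first factor has the modulus of a
  chord of the circle and depends on \<open>s - t\<close>, the second depends on \<open>s + t\<close>. Both factors are spelled
  as literal instances of \<open>1 - 2 * k * cos (s + \<theta>) + k\<^sup>2\<close>, the first with radius \<open>1\<close> and phase \<open>- t\<close>, so
  that the kernel lemmas match them.\<close>

lemma norm_chord_sq:
  "(norm (ellipse w t - ellipse w s))\<^sup>2 = ((a + b) / 2)\<^sup>2 * (1 - 2 * 1 * cos (s + - t) + 1\<^sup>2)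
      * (1 - 2 * k * cos (s + t) + k\<^sup>2)"
proof -
  have "(norm (ellipse w t - ellipse w s))\<^sup>2
      = ((sin (rot_angle w))\<^sup>2 + (cos (rot_angle w))\<^sup>2)
        * (a\<^sup>2 * (cos t - cos s)\<^sup>2 + b\<^sup>2 * (sin t - sin s)\<^sup>2)"
    unfolding power2_norm_eq_inner inner_vec_def sum_2 inner_real_def vector_minus_component
      ellipse_nth by algebra
  also have "\<dots> = a\<^sup>2 * (cos t - cos s)\<^sup>2 + b\<^sup>2 * (sin t - sin s)\<^sup>2" by simp
  also have "\<dots> = (2 - 2 * (cos s * cos t + sin s * sin t))
      * ((a\<^sup>2 + b\<^sup>2) / 2 - (a\<^sup>2 - b\<^sup>2) / 2 * (cos s * cos t - sin s * sin t))"
  proof -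
    have st: "(sin s)\<^sup>2 + (cos s)\<^sup>2 = 1" "(sin t)\<^sup>2 + (cos t)\<^sup>2 = 1" by simp_all
    have "2 * (a\<^sup>2 * (cos t - cos s)\<^sup>2 + b\<^sup>2 * (sin t - sin s)\<^sup>2)
      = (2 - 2 * (cos s * cos t + sin s * sin t))
      * ((a\<^sup>2 + b\<^sup>2) - (a\<^sup>2 - b\<^sup>2) * (cos s * cos t - sin s * sin t))"
      using st by algebra
    then show ?thesis by (simp add: field_simps)
  qed
  also have "(a\<^sup>2 + b\<^sup>2) / 2 - (a\<^sup>2 - b\<^sup>2) / 2 * c = ((a + b) / 2)\<^sup>2 * (1 - 2 * k * c + k\<^sup>2)" for c
  proof -
    have "a + b \<noteq> 0" using ab_pos by simp
    then have "k * (a + b) = a - b" by (simp add: k_eq)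
    then have "2 * ((a\<^sup>2 + b\<^sup>2) - (a\<^sup>2 - b\<^sup>2) * c) = (a + b)\<^sup>2 * (1 - 2 * k * c + k\<^sup>2)" by algebra
    moreover have "(a\<^sup>2 + b\<^sup>2) / 2 - (a\<^sup>2 - b\<^sup>2) / 2 * c = 2 * ((a\<^sup>2 + b\<^sup>2) - (a\<^sup>2 - b\<^sup>2) * c) / 4"
      by (simp add: field_simps)
    ultimately show ?thesis by (simp add: power_divide)
  qed
  finally show ?thesis by (simp add: cos_diff cos_add mult_ac)
qed

lemma confocal_denominator_pos: "0 < 1 - 2 * k * cos u + k\<^sup>2"
proof -
  have "k * cos u \<le> k * 1" using k_bounds by (intro mult_left_mono) auto
  moreover have "0 < (1 - k)\<^sup>2" using k_bounds by simp
  ultimately show ?thesis by (simp add: power2_diff)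
qed

lemma ellipse_noteq:
  assumes "cos (s + - t) \<noteq> 1"
  shows "ellipse w t \<noteq> ellipse w s"
proof
  assume "ellipse w t = ellipse w s"
  then have "((a + b) / 2)\<^sup>2 * (1 - 2 * 1 * cos (s + - t) + 1\<^sup>2) * (1 - 2 * k * cos (s + t) + k\<^sup>2) = 0"
    using norm_chord_sq[of t s] by simp
  moreover have "0 < ((a + b) / 2)\<^sup>2 * (1 - 2 * 1 * cos (s + - t) + 1\<^sup>2) * (1 - 2 * k * cos (s + t) + k\<^sup>2)"
    using assms ab_pos
    by (intro mult_pos_pos confocal_denominator_pos kernel_denominator_pos zero_less_power) auto
  ultimately show False by linarith
qed

lemma G_chord:
  assumes "cos (s + - t) \<noteq> 1"
  shows "G (ellipse w t - ellipse w s)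
    = (ln ((a + b) / 2) + log_kernel 1 (s + - t) + log_kernel k (s + t)) / (2 * pi)"
proof -
  let ?A = "((a + b) / 2)\<^sup>2" and ?B = "1 - 2 * 1 * cos (s + - t) + 1\<^sup>2"
    and ?C = "1 - 2 * k * cos (s + t) + k\<^sup>2"
  have pos: "0 < ?A" "0 < ?B" "0 < ?C"
    using assms ab_pos kernel_denominator_pos[of 1 "s + - t"] confocal_denominator_pos by auto
  have "2 * ln (norm (ellipse w t - ellipse w s)) = ln ((norm (ellipse w t - ellipse w s))\<^sup>2)"
    using ellipse_noteq[OF assms] by (simp add: ln_realpow)
  also have "\<dots> = ln ?A + ln ?B + ln ?C"
    unfolding norm_chord_sq using pos by (simp only: ln_mult_pos mult_pos_pos)
  also have "\<dots> = 2 * (ln ((a + b) / 2) + log_kernel 1 (s + - t) + log_kernel k (s + t))"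
    using ab_pos unfolding log_kernel_def by (simp add: ln_realpow)
  finally show ?thesis by (simp add: G_def)
qed

lemma chord_inner_normal:
  "(ellipse w s - ellipse w t) \<bullet> ellipse_normal w s = a * b * (1 - cos (s + - t)) / Xi w s"
proof -
  have "(ellipse w s - ellipse w t) \<bullet> ellipse_normal w s
      = ((ellipse w s $ 1 - ellipse w t $ 1) * tangent w s $ 2
         - (ellipse w s $ 2 - ellipse w t $ 2) * tangent w s $ 1) / Xi w s"
    by (simp add: ellipse_normal_def inner_vec_def sum_2 diff_divide_distrib Xi_eq)
  also have "\<dots> = ((sin (rot_angle w))\<^sup>2 + (cos (rot_angle w))\<^sup>2) * (a * b)
        * ((sin s)\<^sup>2 + (cos s)\<^sup>2 - (cos s * cos t + sin s * sin t)) / Xi w s"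
    unfolding ellipse_nth tangent_eq[of w s, THEN arg_cong[where f="\<lambda>v. v $ 1"]]
      tangent_eq[of w s, THEN arg_cong[where f="\<lambda>v. v $ 2"]] vector_2
    by (rule arg_cong[where f="\<lambda>x. x / Xi w s"]) algebra
  finally show ?thesis by (simp add: cos_diff)
qed

text \<open>The factor \<open>1 - cos (s - t)\<close> of \<open>chord_inner_normal\<close> cancels the one of \<open>norm_chord_sq\<close>, so the
  double layer kernel has no singularity, and \<open>a b = ((a + b) / 2)\<^sup>2 (1 - k\<^sup>2)\<close> turns the rest into
  the Poisson kernel.\<close>

lemma dG_normal_y_eq:
  assumes "cos (s + - t) \<noteq> 1"
  shows "dG_normal_y w t s * Xi w s = poisson_kernel k (s + t) / (4 * pi)"
proof -
  let ?A = "((a + b) / 2)\<^sup>2" and ?B = "1 - cos (s + - t)"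
    and ?C = "1 - 2 * k * cos (s + t) + k\<^sup>2"
  have pos: "0 < ?A" "0 < ?B" "0 < ?C"
    using assms ab_pos kernel_denominator_pos[of 1 "s + - t"] confocal_denominator_pos by auto
  have "k * (a + b) = a - b" using ab_pos by (simp add: k_eq)
  then have "4 * (a * b) = (a + b)\<^sup>2 * (1 - k\<^sup>2)" by algebra
  then have ab: "a * b = ?A * (1 - k\<^sup>2)" by (simp add: power_divide)
  have "dG_normal_y w t s * Xi w s
      = a * b * ?B / (2 * pi * (norm (ellipse w t - ellipse w s))\<^sup>2)"
    using Xi_pos[of s]
    by (simp add: dG_normal_y_def frechet_derivative_G[OF ellipse_noteq[OF assms]] chord_inner_normal)
  also have "\<dots> = (?A * ?B * (1 - k\<^sup>2)) / (?A * ?B * (4 * pi * ?C))"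
    unfolding norm_chord_sq ab by (simp add: algebra_simps)
  also have "\<dots> = poisson_kernel k (s + t) / (4 * pi)"
    using pos by (simp add: poisson_kernel_def)
  finally show ?thesis .
qed

lemma cos_diff_noteq_one:
  assumes "t \<in> {0..<2 * pi}" "s \<in> {0..<2 * pi}" "s \<noteq> t"
  shows "cos (s + - t) \<noteq> 1"
proof
  assume "cos (s + - t) = 1"
  then obtain n :: int where n: "s - t = of_int n * (2 * pi)"
    unfolding cos_one_2pi_int by (auto simp: mult_ac)
  have "\<bar>s - t\<bar> < 2 * pi" using assms by auto
  then have "\<bar>of_int n :: real\<bar> < 1" unfolding n by (simp add: abs_mult)
  then have "n = 0" by linarith
  then show False using n assms by simp
qed

section \<open>The boundary operators on trigonometric functions\<close>

text \<open>The kernel in \<open>s - t\<close> reproduces the exponential of frequency \<open>i\<close>, while the kernel in \<open>s + t\<close>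
  conjugates it and brings the factor \<open>k\<^sup>i = 2 \<alpha>\<close>. The conjugation is why \<open>\<alpha>\<close> enters with opposite signs for
  sines and cosines.\<close>

lemma has_bochner_integral_S_adj_integrand:
  assumes t: "t \<in> {0..<2 * pi}"
  shows "has_bochner_integral period_measure (S_adj_integrand w (\<lambda>s. cis (real i * s)) t)
    (if i = 0 then of_real ((rho w + ln (focal w / 2)) * Xi w t)
     else of_real (- Xi w t / (2 * real i)) * (cis (real i * t) + of_real (k ^ i) * cis (- real i * t)))"
proof -
  let ?e = "\<lambda>s. cis (real i * s)" and ?X = "of_real (Xi w t / (2 * pi)) :: complex"
  let ?L = "ln ((a + b) / 2)"
  have const: "has_bochner_integral period_measure (\<lambda>s. of_real ?L * ?e s)
      (of_real ?L * (if int i = 0 then 2 * pi else 0))"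
    using has_bochner_integral_mult_right[OF has_bochner_integral_cis[of "int i"], of "of_real ?L"]
    by simp
  have "has_bochner_integral period_measure
      (\<lambda>s. ?X * (of_real ?L * ?e s + (of_real (log_kernel 1 (s + - t)) * ?e s + of_real (log_kernel k (s + t)) * ?e s)))
      (?X * (of_real ?L * (if int i = 0 then 2 * pi else 0)
         + (of_real (- (pi * 1 ^ i / real i)) * cis (- real i * - t)
         + of_real (- (pi * k ^ i / real i)) * cis (- real i * t))))" (is "has_bochner_integral _ ?f ?v")
    using k_bounds
    by (intro has_bochner_integral_mult_right[of ?X] has_bochner_integral_add const log_kernel_integral) auto
  then have "has_bochner_integral period_measure (S_adj_integrand w ?e t) ?v"
  proof (rule has_bochner_integral_period_measure_except[OF _ t])
    fix s assume "s \<in> {0..<2 * pi}" "s \<noteq> t"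
    with t show "S_adj_integrand w ?e t s = ?f s"
      by (simp add: S_adj_integrand_def G_chord[OF cos_diff_noteq_one] Xi_eq field_simps)
  qed
  also have "?v = (if i = 0 then of_real ((rho w + ln (focal w / 2)) * Xi w t)
     else of_real (- Xi w t / (2 * real i)) * (cis (real i * t) + of_real (k ^ i) * cis (- real i * t)))"
  proof (cases "i = 0")
    case True
    then show ?thesis by (simp add: rho_plus_ln_focal)
  next
    case False
    have "of_real (X / (2 * pi)) * (of_real (- (pi / real i)) * E + of_real (- (pi * K / real i)) * F)
        = of_real (- X / (2 * real i)) * (E + of_real K * F)" for X K :: real and E F :: complex
      using False by (simp add: divide_simps) (simp add: algebra_simps)
    from this[of "Xi w t" "cis (real i * t)" "k ^ i" "cis (- real i * t)"] False
    show ?thesis by simp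
  qed
  finally show ?thesis .
qed

text \<open>The weight \<open>\<Xi>\<close> of the eigenfunction cancels the factor \<open>1 / \<Xi>\<close> that the unit normal at \<open>s\<close> brings
  into the kernel.\<close>

lemma has_bochner_integral_K_integrand:
  assumes t: "t \<in> {0..<2 * pi}"
  shows "has_bochner_integral period_measure (K_integrand w (\<lambda>s. of_real (Xi w s) * cis (real i * s)) t)
    (of_real (alpha w i * Xi w t) * cis (- real i * t))"
proof -
  let ?e = "\<lambda>s. cis (real i * s)" and ?X = "of_real (Xi w t / (4 * pi)) :: complex"
  have "has_bochner_integral period_measure
      (\<lambda>s. ?X * (of_real (poisson_kernel k (s + t)) * ?e s))
      (?X * (of_real (2 * pi * k ^ i) * cis (- real i * t)))" (is "has_bochner_integral _ ?f ?v")
    using k_bounds by (intro has_bochner_integral_mult_right poisson_kernel_integral)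
  then have "has_bochner_integral period_measure (K_integrand w (\<lambda>s. of_real (Xi w s) * ?e s) t) ?v"
  proof (rule has_bochner_integral_period_measure_except[OF _ t])
    fix s assume "s \<in> {0..<2 * pi}" "s \<noteq> t"
    with t have "of_real (dG_normal_y w t s * Xi w s) = complex_of_real (poisson_kernel k (s + t) / (4 * pi))"
      by (intro arg_cong[where f = of_real] dG_normal_y_eq cos_diff_noteq_one)
    then show "K_integrand w (\<lambda>s. of_real (Xi w s) * ?e s) t s = ?f s"
      by (simp add: K_integrand_def Xi_eq field_simps)
  qed
  also have "?v = of_real (alpha w i * Xi w t) * cis (- real i * t)"
    by (simp add: alpha_eq)
  finally show ?thesis .
qed

lemma K_q_c:
  assumes "t \<in> {0..<2 * pi}"
  shows "set_integrable lborel {0..<2 * pi} (K_integrand w (q_c w i) t)"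
    and "K_op w (q_c w i) t = of_real (alpha w i) * q_c w i t"
proof -
  have "has_bochner_integral period_measure (K_integrand w (q_c w i) t) (of_real (alpha w i) * q_c w i t)"
    using has_bochner_integral_of_real_Re[OF has_bochner_integral_K_integrand[OF assms, of i]]
    by (simp add: K_integrand_def[abs_def] q_c_def[abs_def] mult_ac)
  then show "set_integrable lborel {0..<2 * pi} (K_integrand w (q_c w i) t)"
    and "K_op w (q_c w i) t = of_real (alpha w i) * q_c w i t"
    by (simp_all add: has_bochner_integral_period_measure_iff K_op_def)
qed

lemma K_q_s:
  assumes "t \<in> {0..<2 * pi}"
  shows "set_integrable lborel {0..<2 * pi} (K_integrand w (q_s w i) t)"
    and "K_op w (q_s w i) t = - of_real (alpha w i) * q_s w i t"
proof -
  have "has_bochner_integral period_measure (K_integrand w (q_s w i) t) (- of_real (alpha w i) * q_s w i t)"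
    using has_bochner_integral_of_real_Im[OF has_bochner_integral_K_integrand[OF assms, of i]]
    by (simp add: K_integrand_def[abs_def] q_s_def[abs_def] mult_ac)
  then show "set_integrable lborel {0..<2 * pi} (K_integrand w (q_s w i) t)"
    and "K_op w (q_s w i) t = - of_real (alpha w i) * q_s w i t"
    by (simp_all add: has_bochner_integral_period_measure_iff K_op_def)
qed

lemma S_adj_cos:
  assumes "t \<in> {0..<2 * pi}"
  shows "set_integrable lborel {0..<2 * pi} (S_adj_integrand w (\<lambda>s. of_real (cos (real i * s))) t)"
    and "S_adj w (\<lambda>s. of_real (cos (real i * s))) t =
      (if i = 0 then of_real ((rho w + ln (focal w / 2)) * Xi w t)
       else of_real (- (1 / real i) * (1 / 2 + alpha w i)) * q_c w i t)"
proof -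
  have "has_bochner_integral period_measure (S_adj_integrand w (\<lambda>s. of_real (cos (real i * s))) t)
      (if i = 0 then of_real ((rho w + ln (focal w / 2)) * Xi w t)
       else of_real (- (1 / real i) * (1 / 2 + alpha w i)) * q_c w i t)"
    using has_bochner_integral_of_real_Re[OF has_bochner_integral_S_adj_integrand[OF assms, of i]]
    by (cases "i = 0") (simp_all add: S_adj_integrand_def[abs_def] q_c_def alpha_eq field_simps)
  then show "set_integrable lborel {0..<2 * pi} (S_adj_integrand w (\<lambda>s. of_real (cos (real i * s))) t)"
    and "S_adj w (\<lambda>s. of_real (cos (real i * s))) t =
      (if i = 0 then of_real ((rho w + ln (focal w / 2)) * Xi w t)
       else of_real (- (1 / real i) * (1 / 2 + alpha w i)) * q_c w i t)"
    by (simp_all add: has_bochner_integral_period_measure_iff S_adj_def)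
qed

lemma S_adj_sin:
  assumes "t \<in> {0..<2 * pi}" and "i \<ge> 1"
  shows "set_integrable lborel {0..<2 * pi} (S_adj_integrand w (\<lambda>s. of_real (sin (real i * s))) t)"
    and "S_adj w (\<lambda>s. of_real (sin (real i * s))) t =
      of_real (- (1 / real i) * (1 / 2 - alpha w i)) * q_s w i t"
proof -
  have "has_bochner_integral period_measure (S_adj_integrand w (\<lambda>s. of_real (sin (real i * s))) t)
      (of_real (- (1 / real i) * (1 / 2 - alpha w i)) * q_s w i t)"
    using has_bochner_integral_of_real_Im[OF has_bochner_integral_S_adj_integrand[OF assms(1), of i]] assms(2)
    by (simp add: S_adj_integrand_def[abs_def] q_s_def alpha_eq field_simps)
  then show "set_integrable lborel {0..<2 * pi} (S_adj_integrand w (\<lambda>s. of_real (sin (real i * s))) t)"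
    and "S_adj w (\<lambda>s. of_real (sin (real i * s))) t =
      of_real (- (1 / real i) * (1 / 2 - alpha w i)) * q_s w i t"
    by (simp_all add: has_bochner_integral_period_measure_iff S_adj_def)
qed

text \<open>On \<open>(0, 1 / (i + 1))\<close> the phase \<open>i t\<close> stays below \<open>1 < \<pi> / 2\<close>, so the cosine is positive there, and for
  \<open>i \<ge> 1\<close> the sine as well.\<close>

lemma phase_bounds:
  assumes "0 < t" "t < 1 / (real i + 1)"
  shows "0 \<le> real i * t" "real i * t < 1" "i \<ge> 1 \<Longrightarrow> 0 < real i * t"
proof -
  have "(real i + 1) * t < 1" using assms by (simp add: field_simps)
  then show "0 \<le> real i * t" "real i * t < 1" "i \<ge> 1 \<Longrightarrow> 0 < real i * t"
    using assms by (auto simp: distrib_right)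
qed

lemma eigenpair_q_c: "L2_eigenpair (K_op w) (of_real (alpha w i)) (q_c w i)"
  unfolding q_c_def[abs_def]
proof (rule L2_eigenpair_of_real)
  show "continuous_on UNIV (\<lambda>t. cos (real i * t) * Xi w t)"
    by (intro continuous_intros continuous_on_Xi)
  have "1 / (real i + 1) \<le> 1" by simp
  then show "1 / (real i + 1) \<le> 2 * pi" using pi_gt3 by linarith
  show "0 < 1 / (real i + 1)" by simp
  show "cos (real i * t) * Xi w t \<noteq> 0" if "0 < t" "t < 1 / (real i + 1)" for t
  proof -
    have "0 < cos (real i * t)"
      using phase_bounds[OF that] pi_gt3 by (intro cos_gt_zero_pi) linarith+
    then show ?thesis using Xi_pos[of t] by simp
  qed
  show "K_op w (\<lambda>t. of_real (cos (real i * t) * Xi w t)) t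
      = of_real (alpha w i) * of_real (cos (real i * t) * Xi w t)" if "t \<in> {0..<2 * pi}" for t
    using K_q_c(2)[OF that, of i] unfolding q_c_def[abs_def] .
qed

lemma eigenpair_q_s:
  assumes "i \<ge> 1"
  shows "L2_eigenpair (K_op w) (- of_real (alpha w i)) (q_s w i)"
  unfolding q_s_def[abs_def]
proof (rule L2_eigenpair_of_real)
  show "continuous_on UNIV (\<lambda>t. sin (real i * t) * Xi w t)"
    by (intro continuous_intros continuous_on_Xi)
  have "1 / (real i + 1) \<le> 1" by simp
  then show "1 / (real i + 1) \<le> 2 * pi" using pi_gt3 by linarith
  show "0 < 1 / (real i + 1)" by simp
  show "sin (real i * t) * Xi w t \<noteq> 0" if "0 < t" "t < 1 / (real i + 1)" for t
  proof -
    have "0 < sin (real i * t)"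
      using phase_bounds[OF that] assms pi_gt3 by (intro sin_gt_zero) linarith+
    then show ?thesis using Xi_pos[of t] by simp
  qed
  show "K_op w (\<lambda>t. of_real (sin (real i * t) * Xi w t)) t
      = - of_real (alpha w i) * of_real (sin (real i * t) * Xi w t)" if "t \<in> {0..<2 * pi}" for t
    using K_q_s(2)[OF that, of i] unfolding q_s_def[abs_def] .
qed

end

theorem theorem5p3:
  fixes w :: ellipse_params
  assumes "semi_major w > semi_minor w" and "semi_minor w > 0"
  shows
    "(\<forall>i\<ge>1. L2_eigenpair (K_op w) (- of_real (alpha w i)) (q_s w i)) \<and>
     (\<forall>i. L2_eigenpair (K_op w) (of_real (alpha w i)) (q_c w i)) \<and>
     (\<forall>i\<ge>1. \<forall>t\<in>{0..<2*pi}.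
        set_integrable lborel {0..<2*pi} (K_integrand w (q_s w i) t) \<and>
        K_op w (q_s w i) t = - of_real (alpha w i) * q_s w i t) \<and>
     (\<forall>i. \<forall>t\<in>{0..<2*pi}.
        set_integrable lborel {0..<2*pi} (K_integrand w (q_c w i) t) \<and>
        K_op w (q_c w i) t = of_real (alpha w i) * q_c w i t) \<and>
     (\<forall>i\<ge>1. \<forall>t\<in>{0..<2*pi}.
        set_integrable lborel {0..<2*pi} (S_adj_integrand w (\<lambda>s. of_real (sin (real i * s))) t) \<and>
        S_adj w (\<lambda>s. of_real (sin (real i * s))) t
          = of_real (- (1 / real i) * (1 / 2 - alpha w i)) * q_s w i t) \<and>
     (\<forall>i\<ge>1. \<forall>t\<in>{0..<2*pi}.
        set_integrable lborel {0..<2*pi} (S_adj_integrand w (\<lambda>s. of_real (cos (real i * s))) t) \<and>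
        S_adj w (\<lambda>s. of_real (cos (real i * s))) t
          = of_real (- (1 / real i) * (1 / 2 + alpha w i)) * q_c w i t) \<and>
     (\<forall>t\<in>{0..<2*pi}.
        set_integrable lborel {0..<2*pi} (S_adj_integrand w (\<lambda>s. of_real (cos (real 0 * s))) t) \<and>
        S_adj w (\<lambda>s. of_real (cos (real 0 * s))) t
          = of_real ((rho w + ln (focal w / 2)) * Xi w t))"
proof -
  interpret proper_ellipse w by unfold_locales (fact assms)+
  show ?thesis
    using eigenpair_q_s eigenpair_q_c K_q_s K_q_c S_adj_sin S_adj_cos S_adj_cos[of _ 0] by auto
qed

end
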